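(* For any $n\ge1$ and any pattern pair $p\in\{(012,102),(012,120),(011,102)\}$, we have $|\mathbf{I}_n(p)|=F_{2n-1}$, where $F_m$ is the $m$-th Fibonacci number.
   Context: An inversion sequence of length $n$ is an integer sequence $e=(e_1,\dots,e_n)$ with $0\le e_i\le i-1$ for all $1\le i\le n$. A word $w_1\cdots w_n$ avoids a pattern $P=p_1\cdots p_k$ if there are no $i_1<\cdots<i_k$ such that $w_{i_1}\cdots w_{i_k}$ is order isomorphic to $P$ (equal letters of $P$ corresponding to equal entries). For a pair $p=(P_1,P_2)$ of patterns, $\mathbf{I}_n(p)$ denotes the set of inversion sequences of length $n$ avoiding both $P_1$ and $P_2$. Fibonacci numbers: $F_0=0$, $F_1=1$, $F_m=F_{m-1}+F_{m-2}$ for $m\ge2$. *)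

theory Defs
  imports "HOL-Number_Theory.Fib" "HOL-Library.Sublist"
begin

text \<open>
  Lists are indexed from 0, so the list entry \<open>e ! i\<close> is the entry $e_{i+1}$ of the
  sequence, and the bound $0 \le e_{i+1} \le (i+1)-1$ reads \<open>e ! i \<le> i\<close>.
\<close>

definition inversion_seqs :: "nat \<Rightarrow> nat list set" where
  "inversion_seqs n = {e. length e = n \<and> (\<forall>i<n. e ! i \<le> i)}"

definition order_isomorphic :: "'a::linorder list \<Rightarrow> 'b::linorder list \<Rightarrow> bool" where
  "order_isomorphic u p \<longleftrightarrow> length u = length p \<and>
     (\<forall>i<length p. \<forall>j<length p. (u ! i < u ! j \<longleftrightarrow> p ! i < p ! j) \<and> (u ! i = u ! j \<longleftrightarrow> p ! i = p ! j))"

definition avoids :: "'a::linorder list \<Rightarrow> 'b::linorder list \<Rightarrow> bool" where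
  "avoids w p \<longleftrightarrow> \<not> (\<exists>u. subseq u w \<and> order_isomorphic u p)"

definition pair_avoiding_inversion_seqs :: "nat \<Rightarrow> nat list \<times> nat list \<Rightarrow> nat list set" where
  "pair_avoiding_inversion_seqs n p =
     {e \<in> inversion_seqs n. avoids e (fst p) \<and> avoids e (snd p)}"

end

theory Submission
  imports Defs
begin

text \<open>
  An inversion sequence starts with 0, so each pattern that begins with its unique smallest letter
  says something about the positive entries alone: avoiding 012 means that they decrease weakly, and
  avoiding 011 means that they are distinct. If the positive entries decrease weakly, then
  neither 102 nor 120 can occur, because both contain an ascent between two letters that are not
  minimal. Hence the first two pairs both define the 012-avoiders.

  For either of the two resulting classes let \<open>a\<^sub>n\<close> be the number of members of length \<open>n\<close> and
  \<open>c\<^sub>n\<close> the number of those containing the entry 1. Three bijections give, for \<open>n \<ge> 1\<close>,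
  \<open>a\<^sub>n\<^sub>+\<^sub>1 = a\<^sub>n + c\<^sub>n\<^sub>+\<^sub>1\<close> and \<open>c\<^sub>n\<^sub>+\<^sub>1 = c\<^sub>n + a\<^sub>n\<close>:

  \<^item> members without the entry 1 arise from members shorter by one by incrementing the positive
    entries and prepending 0 (\<open>bij_betw_raise\<close>);
  \<^item> members that contain 1 and end in 0 arise by appending 0 to shorter members that contain 1
    (\<open>bij_betw_snoc_zero\<close>);
  \<^item> members that contain 1 and end in a positive entry correspond to all shorter members. A 012-avoider
    of this kind ends in 1, and this entry is simply removed (\<open>bij_betw_snoc_one\<close>). A sequence of this
    kind that avoids 011 and 102 has a single 1, and no 0 after it, so removing the initial 0 and
    lowering the positive entries turns that 1 into the last 0, from which it can be recovered
    (\<open>bij_betw_mark\<close>).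

  Since \<open>a\<^sub>1 = 1\<close> and \<open>c\<^sub>1 = 0\<close>, the numbers \<open>c\<^sub>1, a\<^sub>1, c\<^sub>2, a\<^sub>2, \<dots>\<close> are the consecutive Fibonacci numbers
  (\<open>card_eq_fib\<close>).
\<close>

section \<open>Pattern avoidance in terms of pairs of entries\<close>

lemma subseq_pair_Cons:
  "subseq [x, y] (z # zs) \<longleftrightarrow> x = z \<and> y \<in> set zs \<or> subseq [x, y] zs"
  by (auto simp: subseq_singleton_left dest: subseq_Cons')

lemma sorted_wrt_iff_subseq:
  "sorted_wrt R xs \<longleftrightarrow> (\<forall>x y. subseq [x, y] xs \<longrightarrow> R x y)"
  by (induction xs) (auto simp: subseq_pair_Cons simp del: subseq_Cons2_iff)

text \<open>Fixing the first letter of an occurrence leaves a condition on pairs of later entries, and such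
  conditions can be transported along the maps and concatenations below.\<close>

fun no_102 :: "nat list \<Rightarrow> bool" where
  "no_102 [] \<longleftrightarrow> True"
| "no_102 (x # xs) \<longleftrightarrow> sorted_wrt (\<lambda>a c. a < x \<longrightarrow> c \<le> x) xs \<and> no_102 xs"

abbreviation pos_decreasing :: "nat list \<Rightarrow> bool" where
  "pos_decreasing \<equiv> sorted_wrt (\<lambda>x y. x = 0 \<or> y \<le> x)"

abbreviation pos_distinct :: "nat list \<Rightarrow> bool" where
  "pos_distinct \<equiv> sorted_wrt (\<lambda>x y. x = 0 \<or> x \<noteq> y)"

lemma no_102_iff_subseq:
  "no_102 xs \<longleftrightarrow> (\<forall>b a c. subseq [b, a, c] xs \<longrightarrow> \<not> (a < b \<and> b < c))"
proof (induction xs)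
  case Nil
  show ?case by simp
next
  case (Cons x xs)
  have eq: "subseq [b, a, c] (x # xs) \<longleftrightarrow> b = x \<and> subseq [a, c] xs \<or> subseq [b, a, c] xs" for b a c
    by (auto dest: subseq_Cons')
  show ?case
    unfolding no_102.simps eq sorted_wrt_iff_subseq Cons.IH not_less[symmetric] by blast
qed

lemma avoids_length3:
  fixes p :: "nat list"
  assumes "length p = 3"
  shows "avoids w p \<longleftrightarrow> (\<forall>a b c. subseq [a, b, c] w \<longrightarrow> \<not> order_isomorphic [a, b, c] p)"
proof -
  have "\<exists>a b c. u = [a, b, c]" if "order_isomorphic u p" for u :: "'a list"
    using that assms by (auto simp: order_isomorphic_def numeral_3_eq_3 length_Suc_conv)
  then show ?thesis
    unfolding avoids_def by blast
qed

lemma order_isomorphic_iffs: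
  fixes a b c :: nat
  shows "order_isomorphic [a, b, c] [0::nat, 1, 2] \<longleftrightarrow> a < b \<and> b < c"
    and "order_isomorphic [a, b, c] [1::nat, 0, 2] \<longleftrightarrow> b < a \<and> a < c"
    and "order_isomorphic [a, b, c] [1::nat, 2, 0] \<longleftrightarrow> c < a \<and> a < b"
    and "order_isomorphic [a, b, c] [0::nat, 1, 1] \<longleftrightarrow> a < b \<and> b = c"
  by (auto simp: order_isomorphic_def All_less_Suc numeral_3_eq_3)

lemma avoids_iffs:
  fixes w :: "nat list"
  shows "avoids w [0::nat, 1, 2] \<longleftrightarrow> (\<forall>a b c. subseq [a, b, c] w \<longrightarrow> \<not> (a < b \<and> b < c))"
    and "avoids w [1::nat, 0, 2] \<longleftrightarrow> (\<forall>a b c. subseq [a, b, c] w \<longrightarrow> \<not> (b < a \<and> a < c))"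
    and "avoids w [1::nat, 2, 0] \<longleftrightarrow> (\<forall>a b c. subseq [a, b, c] w \<longrightarrow> \<not> (c < a \<and> a < b))"
    and "avoids w [0::nat, 1, 1] \<longleftrightarrow> (\<forall>a b c. subseq [a, b, c] w \<longrightarrow> \<not> (a < b \<and> b = c))"
  by (subst avoids_length3, simp, unfold order_isomorphic_iffs, rule refl)+

lemma avoids_102_iff: "avoids (w :: nat list) [1::nat, 0, 2] \<longleftrightarrow> no_102 w"
  unfolding avoids_iffs no_102_iff_subseq ..

text \<open>The initial 0 lies before and below every pair of entries that starts with a positive one.
  Thus it extends a forbidden pair of positive entries to an occurrence of 012 or 011.\<close>

lemma subseq_pair_tail:
  assumes "subseq [b, c] (0 # w)" "b > (0::nat)"
  shows "subseq [0, b, c] (0 # w)"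
  using assms by (auto simp: subseq_pair_Cons)

lemma avoids_012_iff: "avoids (0 # w) [0::nat, 1, 2] \<longleftrightarrow> pos_decreasing (0 # w)"
proof
  assume av: "avoids (0 # w) [0::nat, 1, 2]"
  have "b = 0 \<or> c \<le> b" if "subseq [b, c] (0 # w)" for b c
    using av subseq_pair_tail[OF that] unfolding avoids_iffs by (meson gr0I not_le_imp_less)
  then show "pos_decreasing (0 # w)"
    unfolding sorted_wrt_iff_subseq by blast
next
  assume dec: "pos_decreasing (0 # w)"
  have "\<not> (a < b \<and> b < c)" if "subseq [a, b, c] (0 # w)" for a b c
  proof -
    have "b = 0 \<or> c \<le> b"
      using dec subseq_Cons'[OF that] unfolding sorted_wrt_iff_subseq by blast
    then show ?thesis by auto
  qed
  then show "avoids (0 # w) [0::nat, 1, 2]"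
    unfolding avoids_iffs by blast
qed

lemma avoids_011_iff: "avoids (0 # w) [0::nat, 1, 1] \<longleftrightarrow> pos_distinct (0 # w)"
proof
  assume av: "avoids (0 # w) [0::nat, 1, 1]"
  have "b = 0 \<or> b \<noteq> c" if "subseq [b, c] (0 # w)" for b c
    using av subseq_pair_tail[OF that] unfolding avoids_iffs by (metis gr0I)
  then show "pos_distinct (0 # w)"
    unfolding sorted_wrt_iff_subseq by blast
next
  assume dist: "pos_distinct (0 # w)"
  have "\<not> (a < b \<and> b = c)" if "subseq [a, b, c] (0 # w)" for a b c
  proof -
    have "b = 0 \<or> b \<noteq> c"
      using dist subseq_Cons'[OF that] unfolding sorted_wrt_iff_subseq by blast
    then show ?thesis by auto
  qed
  then show "avoids (0 # w) [0::nat, 1, 1]"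
    unfolding avoids_iffs by blast
qed

text \<open>In both patterns the letter 1 precedes the letter 2. In an occurrence these two letters
  exceed a third one, so they form an ascent of positive entries.\<close>

lemma pos_decreasing_avoids:
  assumes "pos_decreasing w"
  shows "avoids w [1::nat, 0, 2]" "avoids w [1::nat, 2, 0]"
proof -
  have "\<not> (b < a \<and> a < c)" "\<not> (c < a \<and> a < b)" if "subseq [a, b, c] w" for a b c
  proof -
    have "subseq [a, c] [a, b, c]" "subseq [a, b] [a, b, c]"
      by auto
    then have "subseq [a, c] w" "subseq [a, b] w"
      using that subseq_order.order_trans by blast+
    then have "a = 0 \<or> c \<le> a" "a = 0 \<or> b \<le> a"
      using assms unfolding sorted_wrt_iff_subseq by blast+
    then show "\<not> (b < a \<and> a < c)" "\<not> (c < a \<and> a < b)"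
      by auto
  qed
  then show "avoids w [1::nat, 0, 2]" "avoids w [1::nat, 2, 0]"
    unfolding avoids_iffs by blast+
qed

section \<open>Inversion sequences\<close>

lemma finite_inversion_seqs: "finite (inversion_seqs n)"
proof (rule finite_subset)
  show "inversion_seqs n \<subseteq> {e. set e \<subseteq> {..n} \<and> length e = n}"
    by (fastforce simp: inversion_seqs_def in_set_conv_nth)
qed (simp add: finite_lists_length_eq)

lemma inversion_seqs_1: "inversion_seqs (Suc 0) = {[0]}"
  by (auto simp: inversion_seqs_def length_Suc_conv)

lemma Cons_0_in_inversion_seqs_iff:
  "0 # w \<in> inversion_seqs (Suc n) \<longleftrightarrow> length w = n \<and> (\<forall>i<n. w ! i \<le> Suc i)"
  by (auto simp: inversion_seqs_def All_less_Suc2)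

lemma inversion_seqs_SucE:
  assumes "e \<in> inversion_seqs (Suc n)"
  obtains w where "e = 0 # w"
  using assms by (cases e) (auto simp: inversion_seqs_def)

lemma snoc_in_inversion_seqs_iff:
  "e @ [x] \<in> inversion_seqs (Suc n) \<longleftrightarrow> e \<in> inversion_seqs n \<and> x \<le> n"
  by (auto simp: inversion_seqs_def All_less_Suc nth_append)

text \<open>Removing the first entry moves the others one position to the left, which the decrement makes
  up for in the bounds. Truncated subtraction sends both 0 and 1 to 0; the constructions that
  invert this map differ in how they tell these two entries apart.\<close>

definition lower :: "nat list \<Rightarrow> nat list" where
  "lower e = map (\<lambda>x. x - 1) (tl e)"

lemma lower_Cons [simp]: "lower (x # w) = map (\<lambda>x. x - 1) w"
  by (simp add: lower_def)

lemma lower_in_inversion_seqs: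
  assumes "e \<in> inversion_seqs (Suc n)"
  shows "lower e \<in> inversion_seqs n"
proof -
  obtain w where w: "e = 0 # w"
    using assms by (rule inversion_seqs_SucE)
  show ?thesis
    using assms unfolding w Cons_0_in_inversion_seqs_iff
    by (auto simp: inversion_seqs_def le_diff_conv)
qed

section \<open>The common Fibonacci recursion\<close>

definition raise :: "nat list \<Rightarrow> nat list" where
  "raise f = 0 # map (\<lambda>x. if x = 0 then 0 else Suc x) f"

text \<open>In the absence of 1, an entry becomes 0 under lowering only if it was 0 before.\<close>

lemma bij_betw_raise:
  assumes Q: "\<And>f. Q (raise f) \<longleftrightarrow> Q f"
  shows "bij_betw raise {e \<in> inversion_seqs n. Q e}
           {e \<in> inversion_seqs (Suc n). Q e \<and> 1 \<notin> set e}"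
proof (rule bij_betw_byWitness[where f' = lower])
  have lower_raise: "lower (raise f) = f" for f
    by (simp add: raise_def o_def map_idI)
  have raise_lower: "raise (lower e) = e"
    if e: "e \<in> inversion_seqs (Suc n)" "1 \<notin> set e" for e
  proof -
    obtain w where w: "e = 0 # w"
      using e(1) by (rule inversion_seqs_SucE)
    have "map (\<lambda>x. if x - 1 = 0 then 0 else Suc (x - 1)) w = w"
      using e(2) w by (intro map_idI) (auto simp: le_Suc_eq)
    then show ?thesis
      by (simp add: w raise_def o_def del: One_nat_def)
  qed
  show "\<forall>e\<in>{e \<in> inversion_seqs n. Q e}. lower (raise e) = e"
    using lower_raise by simp
  show "\<forall>e\<in>{e \<in> inversion_seqs (Suc n). Q e \<and> 1 \<notin> set e}. raise (lower e) = e"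
    using raise_lower by simp
  have "raise e \<in> inversion_seqs (Suc n)" "1 \<notin> set (raise e)" if "e \<in> inversion_seqs n" for e
    using that unfolding raise_def Cons_0_in_inversion_seqs_iff by (auto simp: inversion_seqs_def)
  then show "raise ` {e \<in> inversion_seqs n. Q e}
      \<subseteq> {e \<in> inversion_seqs (Suc n). Q e \<and> 1 \<notin> set e}"
    using Q by auto
  show "lower ` {e \<in> inversion_seqs (Suc n). Q e \<and> 1 \<notin> set e} \<subseteq> {e \<in> inversion_seqs n. Q e}"
  proof clarify
    fix e assume "e \<in> inversion_seqs (Suc n)" "Q e" "1 \<notin> set e"
    then show "lower e \<in> inversion_seqs n \<and> Q (lower e)"
      using Q[of "lower e"] raise_lower[of e] lower_in_inversion_seqs[of e n] by simp
  qed
qed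

lemma bij_betw_snoc_zero:
  assumes Q: "\<And>f. Q (f @ [0]) \<longleftrightarrow> Q f"
  shows "bij_betw (\<lambda>e. e @ [0]) {e \<in> inversion_seqs n. Q e \<and> 1 \<in> set e}
           {e \<in> inversion_seqs (Suc n). Q e \<and> 1 \<in> set e \<and> last e = 0}"
proof (rule bij_betw_byWitness[where f' = butlast])
  have snoc: "butlast e @ [0] = e" if "1 \<in> set e" "last e = 0" for e :: "nat list"
    using that by (metis append_butlast_last_id empty_iff list.set(1))
  show "\<forall>e\<in>{e \<in> inversion_seqs (Suc n). Q e \<and> 1 \<in> set e \<and> last e = 0}. butlast e @ [0] = e"
    using snoc by blast
  show "(\<lambda>e. e @ [0]) ` {e \<in> inversion_seqs n. Q e \<and> 1 \<in> set e}
      \<subseteq> {e \<in> inversion_seqs (Suc n). Q e \<and> 1 \<in> set e \<and> last e = 0}"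
    by (auto simp: snoc_in_inversion_seqs_iff Q)
  show "butlast ` {e \<in> inversion_seqs (Suc n). Q e \<and> 1 \<in> set e \<and> last e = 0}
      \<subseteq> {e \<in> inversion_seqs n. Q e \<and> 1 \<in> set e}"
  proof clarify
    fix e assume e: "e \<in> inversion_seqs (Suc n)" "Q e" "1 \<in> set e" "last e = 0"
    have "e = butlast e @ [0]"
      using snoc e by simp
    then obtain f where f: "e = f @ [0]" ..
    with e show "butlast e \<in> inversion_seqs n \<and> Q (butlast e) \<and> 1 \<in> set (butlast e)"
      by (simp add: snoc_in_inversion_seqs_iff Q)
  qed
qed simp

text \<open>The two closure properties of \<open>Q\<close> supply the first two bijections; only the treatment of the
  members that contain 1 and end in a positive entry depends on the class. The claim about
  sequences containing 1 makes the induction go through.\<close>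

lemma card_eq_fib:
  assumes one: "Q [0]"
    and raise: "\<And>f. Q (raise f) \<longleftrightarrow> Q f"
    and zero: "\<And>f. Q (f @ [0]) \<longleftrightarrow> Q f"
    and mark: "\<And>n. bij_betw (m n) {e \<in> inversion_seqs (Suc n). Q e}
                 {e \<in> inversion_seqs (Suc (Suc n)). Q e \<and> 1 \<in> set e \<and> last e \<noteq> 0}"
  shows "card {e \<in> inversion_seqs (Suc n). Q e} = fib (2 * n + 1) \<and>
         card {e \<in> inversion_seqs (Suc n). Q e \<and> 1 \<in> set e} = fib (2 * n)"
proof (induction n)
  case 0
  have X: "{e \<in> inversion_seqs (Suc 0). Q e} = {[0]}"
    and C: "{e \<in> inversion_seqs (Suc 0). Q e \<and> 1 \<in> set e} = {}"
    using one by (auto simp: inversion_seqs_1)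
  show ?case by (simp only: X C) simp
next
  case (Suc n)
  let ?X = "\<lambda>P. {e \<in> inversion_seqs (Suc (Suc n)). Q e \<and> P e}"
  have fin: "finite (?X P)" for P
    by (simp add: finite_inversion_seqs)
  have split_last: "?X (\<lambda>e. 1 \<in> set e) =
      ?X (\<lambda>e. 1 \<in> set e \<and> last e = 0) \<union> ?X (\<lambda>e. 1 \<in> set e \<and> last e \<noteq> 0)"
    by auto
  have "card (?X (\<lambda>e. 1 \<in> set e)) =
      card (?X (\<lambda>e. 1 \<in> set e \<and> last e = 0)) + card (?X (\<lambda>e. 1 \<in> set e \<and> last e \<noteq> 0))"
    unfolding split_last by (rule card_Un_disjoint[OF fin fin]) auto
  also have "\<dots> = fib (2 * n) + fib (2 * n + 1)"
    using bij_betw_same_card[OF bij_betw_snoc_zero[where Q = Q and n = "Suc n", OF zero]]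
      bij_betw_same_card[OF mark[of n]] Suc.IH by simp
  finally have c: "card (?X (\<lambda>e. 1 \<in> set e)) = fib (2 * Suc n)"
    by simp
  have split_one: "{e \<in> inversion_seqs (Suc (Suc n)). Q e} =
      ?X (\<lambda>e. 1 \<notin> set e) \<union> ?X (\<lambda>e. 1 \<in> set e)"
    by auto
  have "card {e \<in> inversion_seqs (Suc (Suc n)). Q e} =
      card (?X (\<lambda>e. 1 \<notin> set e)) + card (?X (\<lambda>e. 1 \<in> set e))"
    unfolding split_one by (rule card_Un_disjoint[OF fin fin]) auto
  also have "\<dots> = fib (2 * n + 1) + fib (2 * Suc n)"
    using bij_betw_same_card[OF bij_betw_raise[where Q = Q and n = "Suc n", OF raise]] Suc.IH c by simp
  also have "\<dots> = fib (2 * Suc n + 1)"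
    by simp
  finally show ?case
    using c by simp
qed

section \<open>Sequences avoiding 012\<close>

text \<open>If the positive entries decrease weakly and 1 is among them, then a positive last entry is 1.
  Conversely, a final 1 is below all positive entries before it, and it respects the bound because
  it is not the first entry.\<close>

lemma bij_betw_snoc_one:
  "bij_betw (\<lambda>e. e @ [1]) {e \<in> inversion_seqs (Suc n). pos_decreasing e}
     {e \<in> inversion_seqs (Suc (Suc n)). pos_decreasing e \<and> 1 \<in> set e \<and> last e \<noteq> 0}"
proof (rule bij_betw_byWitness[where f' = butlast])
  have snoc: "\<exists>f. e = f @ [1] \<and> f \<in> inversion_seqs (Suc n) \<and> pos_decreasing f"
    if e: "e \<in> inversion_seqs (Suc (Suc n))" "pos_decreasing e" "1 \<in> set e" "last e \<noteq> 0" for e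
  proof -
    obtain f x where f: "e = f @ [x]"
      using e(3) by (cases e rule: rev_cases) auto
    then have "x = 1"
      using e by (auto simp: sorted_wrt_append)
    with f e show ?thesis
      by (auto simp: snoc_in_inversion_seqs_iff sorted_wrt_append)
  qed
  show "\<forall>e\<in>{e \<in> inversion_seqs (Suc (Suc n)). pos_decreasing e \<and> 1 \<in> set e \<and> last e \<noteq> 0}.
      butlast e @ [1] = e"
    using snoc by fastforce
  show "butlast ` {e \<in> inversion_seqs (Suc (Suc n)). pos_decreasing e \<and> 1 \<in> set e \<and> last e \<noteq> 0}
      \<subseteq> {e \<in> inversion_seqs (Suc n). pos_decreasing e}"
    using snoc by fastforce
qed (auto simp: snoc_in_inversion_seqs_iff sorted_wrt_append)

lemma card_pos_decreasing:
  "card {e \<in> inversion_seqs (Suc n). pos_decreasing e} = fib (2 * n + 1)"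
proof (rule conjunct1[OF card_eq_fib])
  show "pos_decreasing (raise f) \<longleftrightarrow> pos_decreasing f" for f
    by (auto simp: raise_def sorted_wrt_map intro!: arg_cong[where f = "\<lambda>R. sorted_wrt R f"])
  show "bij_betw (\<lambda>e. e @ [1]) {e \<in> inversion_seqs (Suc n). pos_decreasing e}
     {e \<in> inversion_seqs (Suc (Suc n)). pos_decreasing e \<and> 1 \<in> set e \<and> last e \<noteq> 0}" for n
    by (rule bij_betw_snoc_one)
qed (simp_all add: sorted_wrt_append)

section \<open>Sequences avoiding 011 and 102\<close>

lemma no_102_Cons_zero: "no_102 (0 # xs) \<longleftrightarrow> no_102 xs"
  by (simp add: sorted_wrt_iff_nth_less)

lemma no_102_raise: "no_102 (raise f) \<longleftrightarrow> no_102 f"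
proof -
  have "no_102 (map (\<lambda>x. if x = 0 then 0 else Suc x) f) \<longleftrightarrow> no_102 f"
  proof (induction f)
    case (Cons x f)
    have "sorted_wrt (\<lambda>a c. a < (if x = 0 then 0 else Suc x) \<longrightarrow> c \<le> (if x = 0 then 0 else Suc x))
            (map (\<lambda>x. if x = 0 then 0 else Suc x) f)
        \<longleftrightarrow> sorted_wrt (\<lambda>a c. a < x \<longrightarrow> c \<le> x) f"
      unfolding sorted_wrt_map by (rule arg_cong[where f = "\<lambda>R. sorted_wrt R f"]) (auto simp: fun_eq_iff)
    then show ?case using Cons.IH by simp
  qed simp
  then show ?thesis
    unfolding raise_def no_102_Cons_zero .
qed

lemma no_102_snoc_zero: "no_102 (f @ [0]) \<longleftrightarrow> no_102 f"
  by (induction f) (auto simp: sorted_wrt_append)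

text \<open>Lowering is weakly monotone, so a strict inequality between lowered entries holds already
  between the original ones.\<close>

lemma no_102_map_pred: "no_102 xs \<Longrightarrow> no_102 (map (\<lambda>x. x - 1) xs)"
proof (induction xs)
  case (Cons x xs)
  then show ?case
    by (auto simp: sorted_wrt_map elim: sorted_wrt_mono_rel[rotated])
qed simp

text \<open>All entries are incremented except the zeros before the last zero, so that exactly
  the last zero becomes 1.\<close>

fun mark :: "nat list \<Rightarrow> nat list" where
  "mark [] = []"
| "mark (x # xs) = (if x = 0 \<and> 0 \<in> set xs then 0 else Suc x) # mark xs"

lemma length_mark [simp]: "length (mark f) = length f"
  by (induction f) auto

lemma map_pred_mark [simp]: "map (\<lambda>x. x - 1) (mark f) = f"
  by (induction f) auto

lemma mark_nth_le: "i < length f \<Longrightarrow> mark f ! i \<le> Suc (f ! i)"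
  by (metis le_diff_conv length_mark map_pred_mark nth_map order_refl plus_1_eq_Suc
      add.commute)

lemma mark_eq_map_Suc: "0 \<notin> set f \<Longrightarrow> mark f = map Suc f"
  by (induction f) auto

lemma one_in_mark: "0 \<in> set f \<Longrightarrow> 1 \<in> set (mark f)"
  by (induction f) auto

lemma mark_eq_Nil_iff [simp]: "mark f = [] \<longleftrightarrow> f = []"
  by (cases f) auto

lemma last_mark: "f \<noteq> [] \<Longrightarrow> last (mark f) \<noteq> 0"
  by (induction f) auto

text \<open>This is the property that makes marking reversible: the entry 1 shows where the last of the
  entries 0 and 1 is.\<close>

abbreviation large_after_one :: "nat list \<Rightarrow> bool" where
  "large_after_one \<equiv> sorted_wrt (\<lambda>x y. x = 1 \<longrightarrow> y > 1)"

lemma large_after_one_mark: "large_after_one (mark f)"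
  by (induction f) (auto simp: mark_eq_map_Suc intro!: gr0I)

lemma mark_map_pred:
  assumes "large_after_one xs" "0 \<in> set xs \<longrightarrow> 1 \<in> set xs"
  shows "mark (map (\<lambda>x. x - 1) xs) = xs"
  using assms
proof (induction xs)
  case (Cons x xs)
  have "0 \<in> set xs \<longrightarrow> 1 \<in> set xs"
    using Cons.prems by (cases "x = 1") auto
  then have IH: "mark (map (\<lambda>x. x - 1) xs) = xs"
    using Cons.prems(1) by (intro Cons.IH) auto
  have zero: "0 \<in> (\<lambda>x. x - 1) ` set xs \<longleftrightarrow> 0 \<in> set xs \<or> 1 \<in> set xs"
  proof -
    have pred: "0 = y - 1 \<longleftrightarrow> y = 0 \<or> y = 1" for y :: nat
      by auto
    show ?thesis
      unfolding image_iff pred by blast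
  qed
  consider "x = 0" | "x = 1" | "x > 1"
    by linarith
  then show ?case
  proof cases
    case 1
    then show ?thesis using Cons.prems IH zero by auto
  next
    case 2
    then have "0 \<notin> set xs" "1 \<notin> set xs"
      using Cons.prems(1) by auto
    then show ?thesis using 2 IH zero by simp
  next
    case 3
    then show ?thesis using IH by auto
  qed
qed simp

text \<open>The positive entries are distinct, so 1 is not repeated, and a positive last entry that comes
  after 1 exceeds 1. If 0 came after 1, then 1, this 0 and the last entry would form 102.\<close>

lemma large_after_oneI:
  assumes "no_102 xs" "pos_distinct xs" "last xs \<noteq> 0"
  shows "large_after_one xs"
  using assms
proof (induction xs)
  case (Cons x xs)
  have "y > 1" if "x = 1" "y \<in> set xs" for y
  proof -
    have ne: "xs \<noteq> []"
      using that by auto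
    moreover have "1 \<notin> set xs"
      using Cons.prems(2) that(1) by auto
    ultimately have last: "last xs \<noteq> 0" "last xs \<noteq> 1"
      using Cons.prems(3) by (simp, metis last_in_set)
    have xs: "xs = butlast xs @ [last xs]"
      using ne by simp
    have "sorted_wrt (\<lambda>a c. a < 1 \<longrightarrow> c \<le> 1) (butlast xs @ [last xs])"
      using Cons.prems(1) that(1) xs by simp
    then have "0 \<notin> set (butlast xs)"
      using last by (auto simp: sorted_wrt_append)
    then have "0 \<notin> set xs"
      using last(1) by (subst xs) auto
    with \<open>1 \<notin> set xs\<close> show ?thesis
      using that(2) by (metis less_one nat_neq_iff)
  qed
  moreover have "large_after_one xs"
    using Cons by (cases "xs = []") auto
  ultimately show ?case by simp
qed simp

text \<open>Marking merely separates the last 0 from the earlier ones, so a new 102 would have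
  this new 1 as its first letter and a later 0 as its second, but only larger entries follow the 1.\<close>

lemma no_102_mark: "no_102 f \<Longrightarrow> no_102 (mark f)"
proof (induction f)
  case (Cons x f)
  have "sorted_wrt (\<lambda>a c. a < y \<longrightarrow> c \<le> y) (mark f)"
    if y: "y = (if x = 0 \<and> 0 \<in> set f then 0 else Suc x)" for y
  proof (cases "x = 0")
    case True
    show ?thesis
    proof (cases "0 \<in> set f")
      case True
      then have "y = 0" using y \<open>x = 0\<close> by simp
      then show ?thesis by (simp add: sorted_wrt_iff_nth_less)
    next
      case False
      then show ?thesis using y \<open>x = 0\<close>
        by (simp add: mark_eq_map_Suc sorted_wrt_map sorted_wrt_iff_nth_less)
    qed
  next
    case False
    have "sorted_wrt (\<lambda>a c. a < x \<longrightarrow> c \<le> x) (map (\<lambda>x. x - 1) (mark f))"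
      using Cons.prems by (simp del: One_nat_def)
    then show ?thesis
      unfolding sorted_wrt_map using False y by (elim sorted_wrt_mono_rel[rotated]) auto
  qed
  then show ?case
    using Cons by simp
qed simp

lemma pos_distinct_mark:
  assumes "pos_distinct f"
  shows "pos_distinct (mark f)"
proof -
  have "pos_distinct (map (\<lambda>x. x - 1) (mark f))"
    using assms by (simp del: One_nat_def)
  then have dist: "sorted_wrt (\<lambda>x y. x - 1 = 0 \<or> x - 1 \<noteq> y - 1) (mark f)"
    unfolding sorted_wrt_map .
  show ?thesis
    unfolding sorted_wrt_iff_subseq
  proof (intro allI impI)
    fix x y
    assume xy: "subseq [x, y] (mark f)"
    have "x - 1 = 0 \<or> x - 1 \<noteq> y - 1"
      using dist xy unfolding sorted_wrt_iff_subseq by blast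
    moreover have "x = 1 \<longrightarrow> y > 1"
      using large_after_one_mark[of f] xy unfolding sorted_wrt_iff_subseq by blast
    ultimately show "x = 0 \<or> x \<noteq> y"
      by auto
  qed
qed

lemma pos_distinct_map_pred:
  "pos_distinct xs \<Longrightarrow> pos_distinct (map (\<lambda>x. x - 1) xs)"
  unfolding sorted_wrt_map by (elim sorted_wrt_mono_rel[rotated]) auto

text \<open>The initial 0 guarantees that there is a last zero to be marked, which is why every
  sequence of positive length has an image containing 1.\<close>

lemma bij_betw_mark:
  fixes n
  defines "Q \<equiv> \<lambda>e. pos_distinct e \<and> no_102 e"
  shows "bij_betw (\<lambda>f. 0 # mark f) {e \<in> inversion_seqs (Suc n). Q e}
     {e \<in> inversion_seqs (Suc (Suc n)). Q e \<and> 1 \<in> set e \<and> last e \<noteq> 0}" (is "bij_betw _ ?A ?B")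
proof (rule bij_betw_byWitness[where f' = lower])
  show "\<forall>f\<in>?A. lower (0 # mark f) = f"
    by (simp del: One_nat_def)
  show "\<forall>e\<in>?B. 0 # mark (lower e) = e"
  proof
    fix e assume "e \<in> ?B"
    then obtain w where e: "e = 0 # w" and w: "pos_distinct w" "no_102 w" "1 \<in> set w" "last e \<noteq> 0"
      by (auto simp: Q_def elim!: inversion_seqs_SucE)
    then have "last w \<noteq> 0"
      by (auto split: if_splits)
    then have "mark (map (\<lambda>x. x - 1) w) = w"
      using w large_after_oneI mark_map_pred by blast
    then show "0 # mark (lower e) = e"
      by (simp add: e del: One_nat_def)
  qed
  show "(\<lambda>f. 0 # mark f) ` ?A \<subseteq> ?B"
  proof clarify
    fix f assume f: "f \<in> inversion_seqs (Suc n)" "Q f"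
    then obtain w where w: "f = 0 # w"
      by (auto elim: inversion_seqs_SucE)
    have "mark f ! i \<le> Suc i" if "i < Suc n" for i
      using f that mark_nth_le[of i f] by (force simp: inversion_seqs_def)
    then have "0 # mark f \<in> inversion_seqs (Suc (Suc n))"
      using f(1) unfolding Cons_0_in_inversion_seqs_iff by (simp add: inversion_seqs_def)
    moreover have "Q (0 # mark f)"
      using f pos_distinct_mark[of f] no_102_mark[of f]
      by (simp add: Q_def no_102_Cons_zero del: no_102.simps)
    moreover have "1 \<in> set (mark f)"
      using one_in_mark w by simp
    moreover have "last (mark f) \<noteq> 0"
      using last_mark w by blast
    moreover have "mark f \<noteq> []"
      using w by simp
    ultimately show "0 # mark f \<in> inversion_seqs (Suc (Suc n)) \<and> Q (0 # mark f) \<and>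
        1 \<in> set (0 # mark f) \<and> last (0 # mark f) \<noteq> 0"
      by (simp only: last_ConsR list.set insert_iff) simp
  qed
  show "lower ` ?B \<subseteq> ?A"
  proof clarify
    fix e assume e: "e \<in> inversion_seqs (Suc (Suc n))" "Q e"
    then obtain w where w: "e = 0 # w"
      by (auto elim: inversion_seqs_SucE)
    then have "Q (lower e)"
      using e(2) pos_distinct_map_pred[of w] no_102_map_pred[of w] by (simp add: Q_def)
    then show "lower e \<in> inversion_seqs (Suc n) \<and> Q (lower e)"
      using e(1) lower_in_inversion_seqs by blast
  qed
qed

lemma card_pos_distinct_no_102:
  "card {e \<in> inversion_seqs (Suc n). pos_distinct e \<and> no_102 e} = fib (2 * n + 1)"
proof (rule conjunct1[OF card_eq_fib])
  have "pos_distinct (raise f) \<longleftrightarrow> pos_distinct f" for f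
    by (auto simp: raise_def sorted_wrt_map intro!: arg_cong[where f = "\<lambda>R. sorted_wrt R f"])
  then show "pos_distinct (raise f) \<and> no_102 (raise f) \<longleftrightarrow> pos_distinct f \<and> no_102 f" for f
    by (simp add: no_102_raise)
  show "bij_betw (\<lambda>f. 0 # mark f) {e \<in> inversion_seqs (Suc n). pos_distinct e \<and> no_102 e}
     {e \<in> inversion_seqs (Suc (Suc n)). (pos_distinct e \<and> no_102 e) \<and> 1 \<in> set e \<and> last e \<noteq> 0}" for n
    by (rule bij_betw_mark)
qed (auto simp: sorted_wrt_append no_102_snoc_zero)

section \<open>The enumeration\<close>

theorem theorem3p1:
  fixes n :: nat and p :: "nat list \<times> nat list"
  assumes "n \<ge> 1"
    and "p \<in> {([0,1,2], [1,0,2]), ([0,1,2], [1,2,0]), ([0,1,1], [1,0,2])}"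
  shows "card (pair_avoiding_inversion_seqs n p) = fib (2 * n - 1)"
proof -
  obtain m where m: "n = Suc m"
    using assms(1) by (cases n) auto
  have av012: "avoids e [0::nat, 1, 2] \<longleftrightarrow> pos_decreasing e"
    and av011: "avoids e [0::nat, 1, 1] \<longleftrightarrow> pos_distinct e" if e: "e \<in> inversion_seqs n" for e
  proof -
    obtain w where w: "e = 0 # w"
      using e unfolding m by (rule inversion_seqs_SucE)
    show "avoids e [0::nat, 1, 2] \<longleftrightarrow> pos_decreasing e"
      unfolding w by (rule avoids_012_iff)
    show "avoids e [0::nat, 1, 1] \<longleftrightarrow> pos_distinct e"
      unfolding w by (rule avoids_011_iff)
  qed
  have "pair_avoiding_inversion_seqs n p = {e \<in> inversion_seqs n. pos_decreasing e} \<or>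
        pair_avoiding_inversion_seqs n p = {e \<in> inversion_seqs n. pos_distinct e \<and> no_102 e}"
    using assms(2)
  proof (elim insertE emptyE)
    assume p: "p = ([0,1,2], [1,0,2])"
    have "pair_avoiding_inversion_seqs n p = {e \<in> inversion_seqs n. pos_decreasing e}"
      unfolding p pair_avoiding_inversion_seqs_def fst_conv snd_conv
      using av012 pos_decreasing_avoids(1) by blast
    then show ?thesis ..
  next
    assume p: "p = ([0,1,2], [1,2,0])"
    have "pair_avoiding_inversion_seqs n p = {e \<in> inversion_seqs n. pos_decreasing e}"
      unfolding p pair_avoiding_inversion_seqs_def fst_conv snd_conv
      using av012 pos_decreasing_avoids(2) by blast
    then show ?thesis ..
  next
    assume p: "p = ([0,1,1], [1,0,2])"
    have "pair_avoiding_inversion_seqs n p = {e \<in> inversion_seqs n. pos_distinct e \<and> no_102 e}"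
      unfolding p pair_avoiding_inversion_seqs_def fst_conv snd_conv avoids_102_iff
      using av011 by blast
    then show ?thesis ..
  qed
  then show ?thesis
    using card_pos_decreasing[of m] card_pos_distinct_no_102[of m] by (auto simp: m)
qed

end
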